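(* For every positive integer $n$, $$\mathcal{P}(S_n) = \frac{2}{3} - \frac{1}{3n} + \frac{2}{3n}\cdot\frac{\binom{n-1}{(n-1)/2}}{2^{n-1}}\cdot \mathbf{1}_{n \text{ is odd}}$$ and $$\mathcal{Q}(S_n) = \frac{2}{3} - \frac{2}{3n} + \frac{2}{3n}\cdot\frac{\binom{n}{n/2}}{2^{n}}\cdot \mathbf{1}_{n \text{ is even}},$$ where $S_n$ is the star graph on $n$ vertices and $\mathcal{P}$, $\mathcal{Q}$ are the winning probabilities of an optimal player moving first, respectively second, in the tree search game against a uniformly random opponent.
   Context: A tree is a connected acyclic undirected graph with a finite, positive number of vertices; $|T|$ is the number of vertices of $T$; $T\smallsetminus v$ is the forest obtained by deleting $v$ and its incident edges. $S_n$ is the star graph on $n$ vertices (a center adjacent to $n-1$ leaves; $S_1$ is a single vertex and $S_2$ a single edge). Tree search game on $T$: one vertex of $T$ is selected uniformly at random as the target, unknown to both players. The players alternately guess vertices. If the guess $v$ is the target, the player who made it wins. Otherwise both players are informed which component of $T\smallsetminus v$ contains the target, and the game continues on that component with the other player to move. Here one player plays to maximize their probability of winning, while the opponent always guesses a vertex uniformly at random from among the vertices that could still be the target. $\mathcal{P}(T)$ (resp. $\mathcal{Q}(T)$) is the probability that the optimal player wins when the optimal player moves first (resp. second) on $T$. Equivalently, with $n=|T|$, they are determined recursively by $$\mathcal{P}(T)=\max_{v\in V(T)}\Bigl(\frac1n+\frac1n\sum_{T'}|T'|\,\mathcal{Q}(T')\Bigr),\qquad \mathcal{Q}(T)=\frac1{n^2}\sum_{v\in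 V(T)}\sum_{T'}|T'|\,\mathcal{P}(T'),$$ where $T'$ ranges over the components of $T\smallsetminus v$ (empty sums are $0$). $\mathbf{1}_A$ is $1$ if the condition $A$ holds and $0$ otherwise; a term multiplied by an indicator equal to $0$ is taken to be $0$. *)

theory Defs
  imports "HOL-Probability.Probability_Mass_Function"
begin

text \<open>
  A finite simple graph is given by a finite vertex set and an irreflexive symmetric relation
  \<open>E\<close>; the components of the subgraph induced on \<open>W\<close> are the classes of reachability
  within \<open>W\<close>.
\<close>

definition graph_component :: "('a \<times> 'a) set \<Rightarrow> 'a set \<Rightarrow> 'a \<Rightarrow> 'a set" where
  "graph_component E W t = (Restr E W)\<^sup>* `` {t}"

definition graph_components :: "('a \<times> 'a) set \<Rightarrow> 'a set \<Rightarrow> 'a set set" where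
  "graph_components E W = W // (Restr E W)\<^sup>*"

lemma component_subset: "t \<in> W \<Longrightarrow> graph_component E W t \<subseteq> W"
proof
  fix x assume "t \<in> W" "x \<in> graph_component E W t"
  then have "(t, x) \<in> (Restr E W)\<^sup>*" by (simp add: graph_component_def)
  then show "x \<in> W" using \<open>t \<in> W\<close> by (induction rule: rtrancl_induct) auto
qed

lemma components_eq: "graph_components E W = graph_component E W ` W"
  by (auto simp: graph_components_def graph_component_def quotient_def)

lemma components_subset: "C \<in> graph_components E W \<Longrightarrow> C \<subseteq> W"
  using component_subset by (fastforce simp: components_eq)

text \<open>
  A history lists the wrong guesses made so far by both players, each with the component that was
  revealed to contain the target. A strategy prescribes a possibly randomized guess, given the
  history and the set \<open>C\<close> of vertices that could still be the target.
\<close>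

type_synonym 'a history = "('a \<times> 'a set) list"
type_synonym 'a strategy = "'a history \<Rightarrow> 'a set \<Rightarrow> 'a pmf"

definition legal :: "'a strategy \<Rightarrow> bool" where
  "legal \<sigma> \<longleftrightarrow> (\<forall>h C. finite C \<longrightarrow> C \<noteq> {} \<longrightarrow> set_pmf (\<sigma> h C) \<subseteq> C)"

text \<open>
  \<open>play E \<sigma> opt h C t\<close> is the distribution of the event that the player following \<open>\<sigma>\<close> beats the
  uniformly random opponent, when \<open>t\<close> is the target, \<open>C\<close> is the current component and \<open>opt\<close> says
  whether the player following \<open>\<sigma>\<close> is to move. The conditions \<open>t \<in> C\<close> and \<open>v \<in> C\<close> only serve
  termination: they always hold in games between legal players.
\<close>

function play ::
  "('a \<times> 'a) set \<Rightarrow> 'a strategy \<Rightarrow> bool \<Rightarrow> 'a history \<Rightarrow> 'a set \<Rightarrow> 'a \<Rightarrow> bool pmf" where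
  "play E \<sigma> opt h C t =
    (if finite C \<and> t \<in> C then
       bind_pmf (if opt then \<sigma> h C else pmf_of_set C) (\<lambda>v.
         if v = t then return_pmf opt
         else if v \<in> C then
           let C' = graph_component E (C - {v}) t in play E \<sigma> (\<not> opt) (h @ [(v, C')]) C' t
         else return_pmf False)
     else return_pmf False)"
  by pat_completeness auto
termination
proof (relation "Wellfounded.measure (\<lambda>(E, \<sigma>, opt, h, C, t). card C)", goal_cases)
  case 1
  then show ?case by simp
next
  case (2 E \<sigma> opt h C t v C')
  then have "C' \<subseteq> C - {v}" using component_subset[of t "C - {v}" E] by auto
  with 2 have "C' \<subset> C" "finite C" by auto
  then show ?case by (simp add: psubset_card_mono)
qed

declare play.simps [simp del]

text \<open>The winning probability of \<open>\<sigma>\<close> for a target chosen uniformly from \<open>V\<close>.\<close>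

definition win_prob :: "'a set \<Rightarrow> ('a \<times> 'a) set \<Rightarrow> bool \<Rightarrow> 'a strategy \<Rightarrow> real" where
  "win_prob V E opt \<sigma> = pmf (bind_pmf (pmf_of_set V) (\<lambda>t. play E \<sigma> opt [] V t)) True"

definition \<P> :: "'a set \<Rightarrow> ('a \<times> 'a) set \<Rightarrow> real" where
  "\<P> V E = (SUP \<sigma> \<in> {\<sigma>. legal \<sigma>}. win_prob V E True \<sigma>)"

definition \<Q> :: "'a set \<Rightarrow> ('a \<times> 'a) set \<Rightarrow> real" where
  "\<Q> V E = (SUP \<sigma> \<in> {\<sigma>. legal \<sigma>}. win_prob V E False \<sigma>)"

text \<open>The star has center \<open>0\<close> and leaves \<open>1, \<dots>, n - 1\<close>.\<close>

definition star_verts :: "nat \<Rightarrow> nat set" where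
  "star_verts n = {..<n}"

definition star_edges :: "nat \<Rightarrow> (nat \<times> nat) set" where
  "star_edges n = {0} \<times> {1..<n} \<union> {1..<n} \<times> {0}"

text \<open>The suprema are attained and satisfy the usual recursion for the value of the game.\<close>

lemma sum_components:
  fixes f :: "'a \<Rightarrow> 'b::comm_monoid_add"
  assumes "finite W" "sym E"
  shows "(\<Sum>C\<in>graph_components E W. \<Sum>t\<in>C. f t) = (\<Sum>t\<in>W. f t)"
proof -
  have sy: "sym ((Restr E W)\<^sup>*)"
    using assms(2) by (intro sym_rtrancl) (auto simp: sym_def)
  have eq: "{x \<in> W. graph_component E W x = graph_component E W y} = graph_component E W y" if "y \<in> W" for y
  proof (intro equalityI subsetI)
    fix x assume "x \<in> graph_component E W y"
    then have x: "(y, x) \<in> (Restr E W)\<^sup>*" "x \<in> W"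
      using component_subset[OF that] by (auto simp: graph_component_def)
    then have "(x, y) \<in> (Restr E W)\<^sup>*" using sy by (meson symD)
    with x show "x \<in> {x \<in> W. graph_component E W x = graph_component E W y}"
      by (auto simp: graph_component_def intro: rtrancl_trans)
  qed (auto simp: graph_component_def)
  have "(\<Sum>C\<in>graph_components E W. \<Sum>t\<in>C. f t) =
      (\<Sum>C\<in>graph_components E W. \<Sum>t\<in>{x\<in>W. graph_component E W x = C}. f t)"
    using eq by (intro sum.cong refl) (auto simp: components_eq)
  also have "\<dots> = (\<Sum>t\<in>W. f t)"
    using assms(1) by (intro sum.group) (auto simp: components_eq)
  finally show ?thesis .
qed

lemma component_of_mem:
  assumes "sym E" "C \<in> graph_components E W" "t \<in> C"
  shows "graph_component E W t = C"
proof -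
  have sy: "sym ((Restr E W)\<^sup>*)"
    using assms(1) by (intro sym_rtrancl) (auto simp: sym_def)
  obtain y where y: "C = graph_component E W y" using assms(2) by (auto simp: components_eq)
  have "(y, t) \<in> (Restr E W)\<^sup>*" using assms(3) y by (simp add: graph_component_def)
  moreover from this have "(t, y) \<in> (Restr E W)\<^sup>*" using sy by (meson symD)
  ultimately show ?thesis using y by (auto simp: graph_component_def intro: rtrancl_trans)
qed

text \<open>
  \<open>val E opt C\<close> is the value of the game on \<open>C\<close> multiplied by \<open>card C\<close>.
\<close>

function val :: "('a \<times> 'a) set \<Rightarrow> bool \<Rightarrow> 'a set \<Rightarrow> real" where
  "val E opt C =
    (if finite C \<and> C \<noteq> {} then
       if opt then Max ((\<lambda>v. 1 + (\<Sum>T\<in>graph_components E (C - {v}). val E False T)) ` C)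
       else (\<Sum>v\<in>C. \<Sum>T\<in>graph_components E (C - {v}). val E True T) / card C
     else 0)"
  by pat_completeness auto
termination
proof (relation "Wellfounded.measure (\<lambda>(E, opt, C). card C)", goal_cases)
  case 1
  then show ?case by simp
next
  case (2 E opt C v T)
  then have "T \<subset> C" using components_subset[of T E "C - {v}"] by auto
  with 2 show ?case by (simp add: psubset_card_mono)
next
  case (3 E opt C v T)
  then have "T \<subset> C" using components_subset[of T E "C - {v}"] by auto
  with 3 show ?case by (simp add: psubset_card_mono)
qed

declare val.simps [simp del]

definition total_win :: "('a \<times> 'a) set \<Rightarrow> 'a strategy \<Rightarrow> bool \<Rightarrow> 'a history \<Rightarrow> 'a set \<Rightarrow> real" where
  "total_win E \<sigma> opt h C = (\<Sum>t\<in>C. pmf (play E \<sigma> opt h C t) True)"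

lemma total_step:
  assumes C: "finite C" "C \<noteq> {}" and E: "sym E" and \<sigma>: "legal \<sigma>"
  shows "total_win E \<sigma> opt h C = (\<Sum>v\<in>C. pmf (if opt then \<sigma> h C else pmf_of_set C) v *
    (of_bool opt + (\<Sum>T\<in>graph_components E (C - {v}). total_win E \<sigma> (\<not> opt) (h @ [(v, T)]) T)))"
proof -
  define p where "p = (if opt then \<sigma> h C else pmf_of_set C)"
  have p: "set_pmf p \<subseteq> C" using C \<sigma> by (auto simp: p_def legal_def)
  define g where "g v t = (let C' = graph_component E (C - {v}) t in
    pmf (play E \<sigma> (\<not> opt) (h @ [(v, C')]) C' t) True)" for v t
  have "pmf (play E \<sigma> opt h C t) True = (\<Sum>v\<in>C. pmf p v * (if v = t then of_bool opt else g v t))"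
    if "t \<in> C" for t
    using C that p
    by (subst play.simps)
      (auto simp: pmf_bind integral_measure_pmf_real[where A = C] subset_iff p_def[symmetric] g_def Let_def
        mult.commute intro!: sum.cong)
  then have "total_win E \<sigma> opt h C =
      (\<Sum>t\<in>C. \<Sum>v\<in>C. pmf p v * (if v = t then of_bool opt else g v t))"
    by (simp add: total_win_def)
  also have "\<dots> = (\<Sum>v\<in>C. pmf p v * (\<Sum>t\<in>C. if v = t then of_bool opt else g v t))"
    by (subst sum.swap) (simp add: sum_distrib_left)
  also have "\<dots> = (\<Sum>v\<in>C. pmf p v *
     (of_bool opt + (\<Sum>T\<in>graph_components E (C - {v}). total_win E \<sigma> (\<not> opt) (h @ [(v, T)]) T)))"
  proof (intro sum.cong refl arg_cong2[of _ _ _ _ "(*)"])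
    fix v assume v: "v \<in> C"
    have "(\<Sum>t\<in>C. if v = t then of_bool opt else g v t) =
        (of_bool opt :: real) + (\<Sum>t\<in>C - {v}. if v = t then of_bool opt else g v t)"
      using C v by (subst sum.remove[of C v]) auto
    also have "(\<Sum>t\<in>C - {v}. if v = t then of_bool opt else g v t) = (\<Sum>t\<in>C - {v}. g v t)"
      by (intro sum.cong) auto
    also have "\<dots> = (\<Sum>T\<in>graph_components E (C - {v}). \<Sum>t\<in>T. g v t)"
      using C E by (simp add: sum_components)
    also have "\<dots> = (\<Sum>T\<in>graph_components E (C - {v}). total_win E \<sigma> (\<not> opt) (h @ [(v, T)]) T)"
      unfolding total_win_def g_def
      by (intro sum.cong refl) (simp add: component_of_mem[OF E])
    finally show "(\<Sum>t\<in>C. if v = t then of_bool opt else g v t) =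
      of_bool opt + (\<Sum>T\<in>graph_components E (C - {v}). total_win E \<sigma> (\<not> opt) (h @ [(v, T)]) T)" .
  qed
  finally show ?thesis unfolding p_def .
qed

lemma component_psubset:
  "v \<in> C \<Longrightarrow> T \<in> graph_components E (C - {v}) \<Longrightarrow> T \<subset> C"
  using components_subset[of T E "C - {v}"] by auto

lemma components_empty_notin: "{} \<notin> graph_components E W"
  by (auto simp: components_eq graph_component_def)

lemma total_le_val:
  assumes "sym E" "legal \<sigma>" "finite C" "C \<noteq> {}"
  shows "total_win E \<sigma> opt h C \<le> val E opt C"
  using assms(3,4)
proof (induction C arbitrary: opt h rule: finite_psubset_induct)
  case (psubset C)
  have IH: "(\<Sum>T\<in>graph_components E (C - {v}). total_win E \<sigma> b (h @ [(v, T)]) T) \<le>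
      (\<Sum>T\<in>graph_components E (C - {v}). val E b T)" if "v \<in> C" for v b
  proof (rule sum_mono)
    fix T assume "T \<in> graph_components E (C - {v})"
    then have "T \<subset> C" "T \<noteq> {}"
      using component_psubset[OF that] components_empty_notin by blast+
    then show "total_win E \<sigma> b (h @ [(v, T)]) T \<le> val E b T" by (rule psubset.IH)
  qed
  show ?case
  proof (cases opt)
    case True
    have s: "(\<Sum>v\<in>C. pmf (\<sigma> h C) v) = 1"
      using assms(2) psubset by (intro sum_pmf_eq_1) (auto simp: legal_def)
    have le: "1 + (\<Sum>T\<in>graph_components E (C - {v}). total_win E \<sigma> False (h @ [(v, T)]) T) \<le> val E True C"
      if "v \<in> C" for v
    proof -
      have "1 + (\<Sum>T\<in>graph_components E (C - {v}). val E False T) \<le> val E True C"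
        using psubset.hyps psubset.prems that by (subst val.simps) auto
      with IH[OF that, of False] show ?thesis by simp
    qed
    have "total_win E \<sigma> True h C \<le> (\<Sum>v\<in>C. pmf (\<sigma> h C) v * val E True C)"
      using le by (subst total_step) (auto simp: assms psubset intro!: sum_mono mult_left_mono)
    also have "\<dots> = val E True C" using s by (simp flip: sum_distrib_right)
    finally show ?thesis using True by simp
  next
    case False
    have "total_win E \<sigma> False h C =
        (\<Sum>v\<in>C. \<Sum>T\<in>graph_components E (C - {v}). total_win E \<sigma> True (h @ [(v, T)]) T) / card C"
      using psubset by (subst total_step) (simp_all add: assms sum_divide_distrib)
    also have "\<dots> \<le> val E False C"
      using psubset.hyps psubset.prems
      by (subst val.simps) (simp add: divide_right_mono sum_mono IH)
    finally show ?thesis using False by simp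
  qed
qed

lemma val_attained:
  assumes "sym E"
  obtains \<sigma> where "legal \<sigma>"
    "\<And>C opt h. finite C \<Longrightarrow> C \<noteq> {} \<Longrightarrow> total_win E \<sigma> opt h C = val E opt C"
proof -
  define f where "f C v = 1 + (\<Sum>T\<in>graph_components E (C - {v}). val E False T)" for C v
  have "\<exists>v. finite C \<longrightarrow> C \<noteq> {} \<longrightarrow> v \<in> C \<and> f C v = Max (f C ` C)" for C
    using Max_in[of "f C ` C"] by (metis (no_types, lifting) finite_imageI image_is_empty imageE)
  then obtain s where s: "\<And>C. finite C \<Longrightarrow> C \<noteq> {} \<Longrightarrow> s C \<in> C \<and> f C (s C) = Max (f C ` C)"
    by metis
  define \<sigma> where "\<sigma> = (\<lambda>(h :: 'a history) C. return_pmf (s C))"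
  have leg: "legal \<sigma>" using s by (simp add: legal_def \<sigma>_def)
  have "total_win E \<sigma> opt h C = val E opt C" if "finite C" "C \<noteq> {}" for C opt h
    using that
  proof (induction C arbitrary: opt h rule: finite_psubset_induct)
    case (psubset C)
    have IH: "(\<Sum>T\<in>graph_components E (C - {v}). total_win E \<sigma> b (h @ [(v, T)]) T) =
        (\<Sum>T\<in>graph_components E (C - {v}). val E b T)" if "v \<in> C" for v b
    proof (rule sum.cong[OF refl])
      fix T assume "T \<in> graph_components E (C - {v})"
      then have "T \<subset> C" "T \<noteq> {}"
        using component_psubset[OF that] components_empty_notin by blast+
      then show "total_win E \<sigma> b (h @ [(v, T)]) T = val E b T" by (rule psubset.IH)
    qed
    show ?case
    proof (cases opt)
      case True
      have "total_win E \<sigma> True h C = (\<Sum>v\<in>C. if v = s C then f C v else 0)"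
        using IH by (subst total_step[OF psubset.hyps psubset.prems assms leg])
          (auto simp: \<sigma>_def f_def indicator_def intro!: sum.cong)
      also have "\<dots> = Max (f C ` C)" using s[of C] psubset by simp
      also have "\<dots> = val E True C" using psubset by (subst val.simps) (simp add: f_def[abs_def])
      finally show ?thesis using True by simp
    next
      case False
      then show ?thesis using IH[of _ True] psubset
        by (subst total_step, (simp_all add: assms leg)[4], subst val.simps)
          (auto simp: sum_divide_distrib intro!: sum.cong)
    qed
  qed
  with leg that show thesis by blast
qed

lemma win_prob_eq_total:
  "finite V \<Longrightarrow> V \<noteq> {} \<Longrightarrow> win_prob V E opt \<sigma> = total_win E \<sigma> opt [] V / card V"
  by (simp add: win_prob_def total_win_def pmf_bind integral_pmf_of_set)

lemma SUP_win_prob: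
  assumes "finite V" "V \<noteq> {}" "sym E"
  shows "(SUP \<sigma> \<in> {\<sigma>. legal \<sigma>}. win_prob V E opt \<sigma>) = val E opt V / card V"
proof -
  obtain \<sigma> where \<sigma>: "legal \<sigma>" "total_win E \<sigma> opt [] V = val E opt V"
    using val_attained[OF assms(3)] assms(1,2) by metis
  show ?thesis
  proof (rule cSup_eq_maximum)
    show "val E opt V / card V \<in> win_prob V E opt ` {\<sigma>. legal \<sigma>}"
      using \<sigma> assms by (auto simp: win_prob_eq_total intro!: image_eqI[of _ _ \<sigma>])
  qed (use assms in \<open>auto simp: win_prob_eq_total intro!: divide_right_mono total_le_val\<close>)
qed

lemma card_times_value:
  assumes "finite V" "sym E" "v \<in> V" "T \<in> graph_components E (V - {v})"
  shows "card T * \<P> T E = val E True T" "card T * \<Q> T E = val E False T"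
proof -
  have "finite T" "T \<noteq> {}"
    using assms component_psubset[OF assms(3,4)] components_empty_notin
    by (auto dest: finite_subset)
  then show "card T * \<P> T E = val E True T" "card T * \<Q> T E = val E False T"
    using assms(2) by (simp_all add: \<P>_def \<Q>_def SUP_win_prob)
qed

theorem \<P>_recursion:
  assumes "finite V" "V \<noteq> {}" "sym E"
  shows "\<P> V E = (MAX v\<in>V. 1 / card V +
    1 / card V * (\<Sum>T\<in>graph_components E (V - {v}). card T * \<Q> T E))"
proof -
  let ?f = "\<lambda>v. 1 + (\<Sum>T\<in>graph_components E (V - {v}). val E False T)"
  have "\<P> V E = Max (?f ` V) / card V"
    using assms by (simp add: \<P>_def SUP_win_prob val.simps[of E True V])
  also have "\<dots> = Max ((\<lambda>x. x / card V) ` ?f ` V)"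
    using assms by (intro mono_Max_commute) (auto simp: mono_def divide_right_mono)
  also have "(\<lambda>x. x / card V) ` ?f ` V = (\<lambda>v. 1 / card V +
      1 / card V * (\<Sum>T\<in>graph_components E (V - {v}). card T * \<Q> T E)) ` V"
    using assms by (auto simp: image_image card_times_value add_divide_distrib intro!: image_cong)
  finally show ?thesis .
qed

theorem \<Q>_recursion:
  assumes "finite V" "V \<noteq> {}" "sym E"
  shows "\<Q> V E = 1 / (card V)\<^sup>2 *
    (\<Sum>v\<in>V. \<Sum>T\<in>graph_components E (V - {v}). card T * \<P> T E)"
proof -
  have "\<Q> V E = (\<Sum>v\<in>V. \<Sum>T\<in>graph_components E (V - {v}). val E True T) / card V / card V"
    using assms by (simp add: \<Q>_def SUP_win_prob val.simps[of E False V])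
  also have "(\<Sum>v\<in>V. \<Sum>T\<in>graph_components E (V - {v}). val E True T) =
      (\<Sum>v\<in>V. \<Sum>T\<in>graph_components E (V - {v}). card T * \<P> T E)"
    using assms by (intro sum.cong refl) (simp add: card_times_value)
  finally show ?thesis by (simp add: power2_eq_square)
qed

end

theory Submission
  imports Defs
begin

text \<open>
  Deleting the center of a star leaves isolated vertices, while deleting a leaf leaves a smaller
  star; so every position of the game is a star or a single vertex.  On a single vertex the player
  to move wins.  Hence guessing the center of a larger star hands the win to the opponent unless
  the guess is right, and a leaf is never worse for the optimal player.  With \<open>q\<^sub>n\<close> denoting \<open>n\<close>
  times the value of the star on \<open>n\<close> vertices for the optimal player moving second, and \<open>p\<^sub>n\<close> the
  same for moving first, this gives \<open>p\<^sub>n = 1 + q\<^bsub>n-1\<^esub>\<close>, where \<open>q\<^sub>0 = 0\<close>.  The random opponent hits the center with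
  probability \<open>1 / n\<close>, after which the optimal player wins on each of the \<open>n - 1\<close> leaves, and hits a
  leaf otherwise, so for \<open>n \<ge> 2\<close>
    \<open>q\<^sub>n = ((n - 1) + (n - 1) p\<^bsub>n-1\<^esub>) / n = (n - 1) / n \<cdot> (2 + q\<^bsub>n-2\<^esub>)\<close>.

  The affine function \<open>2 (n - 1) / 3\<close> satisfies this recursion, and it has the right value at
  \<open>n = 1\<close> but misses \<open>q\<^sub>0 = 0\<close> by \<open>2 / 3\<close>.  The error is confined to even \<open>n\<close>, where it is multiplied by
  \<open>(n - 1) / n\<close> in every step, exactly like the central binomial probability
  \<open>(n choose n / 2) / 2\<^sup>n\<close>.  The lemmas \<open>return_prob_step\<close> and \<open>star_second_step\<close> are this
  computation, and \<open>val_star\<close> identifies the two sequences with the values of the game.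
\<close>

text \<open>The probability that a simple random walk on the integers is back at its origin at time \<open>n\<close>.\<close>

definition return_prob :: "nat \<Rightarrow> real" where
  "return_prob n = real (n choose (n div 2)) / 2 ^ n * of_bool (even n)"

lemma central_binomial_step:
  "(k + 1) * ((2 * k + 2) choose (k + 1)) = 2 * (2 * k + 1) * ((2 * k) choose k)"
proof -
  have "(k + 1) * ((2 * k + 2) choose (k + 1)) = 2 * ((k + 1) * ((2 * k + 1) choose k))"
    using Suc_times_binomial[of k "2 * k + 1"] by simp
  also have "(k + 1) * ((2 * k + 1) choose k) = (2 * k + 1) * ((2 * k) choose k)"
    using binomial_absorb_comp[of "2 * k + 1" k] by simp
  finally show ?thesis by simp
qed

lemma return_prob_step: "return_prob (n + 2) = (n + 1) / (n + 2) * return_prob n"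
proof (cases "even n")
  case True
  then obtain k where n: "n = 2 * k" by blast
  have "real (k + 1) * real ((2 * k + 2) choose (k + 1)) =
      2 * (2 * real k + 1) * real ((2 * k) choose k)"
    using arg_cong[OF central_binomial_step[of k], of real] by (simp only: of_nat_mult) simp
  then have "real ((2 * k + 2) choose (k + 1)) =
      2 * (2 * real k + 1) * real ((2 * k) choose k) / (real k + 1)"
    by (simp add: field_simps)
  then show ?thesis
    by (simp add: return_prob_def n power_add divide_simps del: binomial_Suc_Suc)
      (simp add: algebra_simps)
qed (simp add: return_prob_def)

text \<open>
  \<open>star_second n\<close> is the closed form of \<open>q\<^sub>n\<close>; it includes the value \<open>0\<close> at \<open>n = 0\<close>, for which
  there is no star.
\<close>

definition star_second :: "nat \<Rightarrow> real" where
  "star_second n = 2 / 3 * (real n - 1 + return_prob n)"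

lemma star_second_0: "star_second 0 = 0" and star_second_1: "star_second (Suc 0) = 0"
  by (simp_all add: star_second_def return_prob_def)

lemma star_second_step: "star_second (n + 2) = (n + 1) / (n + 2) * (2 + star_second n)"
  unfolding star_second_def return_prob_step by (simp add: field_simps)

lemma star_second_nonneg: "star_second n \<ge> 0"
  by (cases n) (simp_all add: star_second_0, simp add: star_second_def return_prob_def)

lemma sym_star_edges: "sym (star_edges n)"
  by (auto simp: sym_def star_edges_def)

lemma components_substar:
  assumes "L \<subseteq> {1..<n}"
  shows "graph_components (star_edges n) (insert 0 L) = {insert 0 L}"
proof -
  let ?R = "Restr (star_edges n) (insert 0 L)"
  have center: "(x, 0) \<in> ?R\<^sup>*" "(0, x) \<in> ?R\<^sup>*" if "x \<in> insert 0 L" for x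
    using that assms by (cases "x = 0"; auto simp: star_edges_def intro!: r_into_rtrancl)+
  have "graph_component (star_edges n) (insert 0 L) x = insert 0 L" if "x \<in> insert 0 L" for x
  proof
    show "insert 0 L \<subseteq> graph_component (star_edges n) (insert 0 L) x"
      using center that unfolding graph_component_def by (blast intro: rtrancl_trans)
  qed (rule component_subset[OF that])
  then show ?thesis by (auto simp: components_eq)
qed

lemma components_leaves:
  assumes "0 \<notin> L"
  shows "graph_components (star_edges n) L = (\<lambda>x. {x}) ` L"
proof -
  have "Restr (star_edges n) L = {}"
    using assms by (auto simp: star_edges_def)
  then show ?thesis by (auto simp: components_eq graph_component_def)
qed

lemma sum_components_leaves:
  fixes f :: "nat set \<Rightarrow> real"
  assumes "0 \<notin> L"
  shows "(\<Sum>T\<in>graph_components (star_edges n) L. f T) = (\<Sum>x\<in>L. f {x})"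
  by (simp add: components_leaves[OF assms] sum.reindex)

lemma val_singleton: "val E opt {x} = of_bool opt"
  by (subst val.simps) (simp add: graph_components_def)

text \<open>
  The positions with more than one vertex that arise from a star on \<open>n\<close> vertices keep its center and
  some set \<open>L\<close> of its leaves, so the induction runs over \<open>L\<close> with the edge relation held fixed.  Both
  values are needed at once, since each is computed from the other on a star with one leaf less.
\<close>

lemma val_star:
  assumes "L \<subseteq> {1..<n}"
  shows "val (star_edges n) True (insert 0 L) = 1 + star_second (card L)"
    and "val (star_edges n) False (insert 0 L) = star_second (card L + 1)"
proof -
  have "finite L" using assms finite_subset by blast
  then have "val (star_edges n) True (insert 0 L) = 1 + star_second (card L) \<and>
    val (star_edges n) False (insert 0 L) = star_second (card L + 1)"
    using assms
  proof (induction L rule: finite_psubset_induct)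
    case (psubset L)
    let ?E = "star_edges n"
    have notin: "0 \<notin> L" using psubset.prems by auto
    have center: "(\<Sum>T\<in>graph_components ?E (insert 0 L - {0}). val ?E b T) = card L * of_bool b" for b
      using notin by (simp add: sum_components_leaves val_singleton)
    have leaf: "(\<Sum>T\<in>graph_components ?E (insert 0 L - {v}). val ?E b T) =
        (if b then 1 + star_second (card L - 1) else star_second (card L))" if "v \<in> L" for v b
    proof -
      have "insert 0 L - {v} = insert 0 (L - {v})" using notin that by auto
      moreover have "L - {v} \<subset> L" "L - {v} \<subseteq> {1..<n}" using psubset.prems that by auto
      moreover have "card L > 0" using psubset.hyps that card_gt_0_iff by blast
      ultimately show ?thesis
        using psubset.IH[of "L - {v}"] components_substar[of "L - {v}" n] psubset.hyps that
        by simp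
    qed
    let ?f = "\<lambda>v. 1 + (\<Sum>T\<in>graph_components ?E (insert 0 L - {v}). val ?E False T)"
    have f0: "?f 0 = 1" using center[of False] by simp
    have fL: "?f v = 1 + star_second (card L)" if "v \<in> L" for v using leaf[OF that, of False] by simp
    have "Max (?f ` insert 0 L) = 1 + star_second (card L)"
    proof (rule Max_eqI)
      fix y assume "y \<in> ?f ` insert 0 L"
      then show "y \<le> 1 + star_second (card L)"
        using f0 fL star_second_nonneg[of "card L"] by auto
    next
      \<comment> \<open>The maximum is attained at any leaf; if there is none, the center does as well.\<close>
      show "1 + star_second (card L) \<in> ?f ` insert 0 L"
      proof (cases "L = {}")
        case True
        then show ?thesis using f0 by (auto simp: star_second_0)
      next
        case False
        then obtain v where "v \<in> L" by blast
        then show ?thesis using fL[of v] by (intro image_eqI[of _ _ v]) auto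
      qed
    qed (use psubset.hyps in simp)
    then have first: "val ?E True (insert 0 L) = 1 + star_second (card L)"
      using psubset.hyps by (subst val.simps) simp
    have "(\<Sum>v\<in>insert 0 L. \<Sum>T\<in>graph_components ?E (insert 0 L - {v}). val ?E True T) =
        card L + (\<Sum>v\<in>L. 1 + star_second (card L - 1))"
      using psubset.hyps notin center[of True] leaf[of _ True]
      by (subst sum.insert) (auto intro!: sum.cong)
    also have "\<dots> = card L * (2 + star_second (card L - 1))"
      by (simp add: algebra_simps)
    finally have "val ?E False (insert 0 L) =
        card L * (2 + star_second (card L - 1)) / (card L + 1)"
      using psubset.hyps notin by (subst val.simps) simp
    also have "\<dots> = star_second (card L + 1)"
    proof (cases "card L")
      case 0
      then show ?thesis by (simp add: star_second_1)
    next
      case (Suc m)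
      then show ?thesis using star_second_step[of m] by (simp add: add.commute)
    qed
    finally show ?case using first by blast
  qed
  then show "val (star_edges n) True (insert 0 L) = 1 + star_second (card L)"
    and "val (star_edges n) False (insert 0 L) = star_second (card L + 1)"
    by blast+
qed

theorem theorem4p1:
  fixes n :: nat
  assumes "n \<ge> 1"
  shows "\<P> (star_verts n) (star_edges n) =
      2 / 3 - 1 / (3 * real n) +
      2 / (3 * real n) * (real ((n - 1) choose ((n - 1) div 2)) / 2 ^ (n - 1)) * of_bool (odd n)
    \<and> \<Q> (star_verts n) (star_edges n) =
      2 / 3 - 2 / (3 * real n) +
      2 / (3 * real n) * (real (n choose (n div 2)) / 2 ^ n) * of_bool (even n)"
proof -
  have V: "star_verts n = insert 0 {1..<n}" using assms by (auto simp: star_verts_def)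
  have "\<P> (star_verts n) (star_edges n) = (1 + star_second (n - 1)) / n"
    using val_star(1)[of "{1..<n}" n] assms
    by (simp add: \<P>_def SUP_win_prob sym_star_edges V)
  moreover have "(1 + star_second (n - 1)) / n =
      2 / 3 - 1 / (3 * real n) + 2 / (3 * real n) * return_prob (n - 1)"
    using assms by (simp add: star_second_def of_nat_diff field_simps)
  moreover have "return_prob (n - 1) =
      real ((n - 1) choose ((n - 1) div 2)) / 2 ^ (n - 1) * of_bool (odd n)"
    using assms by (simp add: return_prob_def)
  moreover have "\<Q> (star_verts n) (star_edges n) = star_second n / n"
    using val_star(2)[of "{1..<n}" n] assms
    by (simp add: \<Q>_def SUP_win_prob sym_star_edges V)
  moreover have "star_second n / n = 2 / 3 - 2 / (3 * real n) + 2 / (3 * real n) * return_prob n"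
    using assms by (simp add: star_second_def field_simps)
  ultimately show ?thesis by (simp only: return_prob_def mult.assoc)
qed

end
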